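(* Let $f,g:\mathbb{R}\to\mathbb{R}$. If $\widehat f$ exists at $s\in\mathbb{R}$ and $g\in L^1\cap\mathcal{BV}$ then $\widehat{f\ast g}(s)=\widehat f(s)\,\widehat g(s)$.
   Context: All integrals are Henstock--Kurzweil integrals; complex-valued functions are integrated by real and imaginary parts. $\mathcal{BV}$ is the set of functions of bounded variation on $\mathbb{R}$. The Fourier transform is $\widehat f(s)=\int_{-\infty}^\infty e^{-isx}f(x)\,dx$, which exists at $s$ if $x\mapsto e^{-isx}f(x)$ is Henstock--Kurzweil integrable on $\mathbb{R}$. The convolution is $f\ast g(x)=\int_{-\infty}^\infty f(x-t)g(t)\,dt$. *)

theory Defs
  imports "HOL-Analysis.Analysis"
begin

text \<open>
  The library integral over \<^term>\<open>UNIV :: real set\<close> is the limit of the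
  Henstock--Kurzweil integrals over all compact intervals exhausting the line; by Hake's
  theorem this is the Henstock--Kurzweil integral on the real line. Since \<^term>\<open>integral\<close>
  is 0 for non-integrable functions, existence is stated by separate predicates.
\<close>

definition bounded_variation :: "(real \<Rightarrow> real) \<Rightarrow> bool" where
  "bounded_variation g \<longleftrightarrow>
     (\<exists>M. \<forall>n (x :: nat \<Rightarrow> real). (\<forall>i<n. x i \<le> x (Suc i)) \<longrightarrow>
        (\<Sum>i<n. \<bar>g (x (Suc i)) - g (x i)\<bar>) \<le> M)"

definition fourier_exists :: "(real \<Rightarrow> real) \<Rightarrow> real \<Rightarrow> bool" where
  "fourier_exists f s \<longleftrightarrow>
     (\<lambda>x. exp (- \<i> * of_real s * of_real x) * complex_of_real (f x)) integrable_on UNIV"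

definition fourier :: "(real \<Rightarrow> real) \<Rightarrow> real \<Rightarrow> complex" where
  "fourier f s =
     integral UNIV (\<lambda>x. exp (- \<i> * of_real s * of_real x) * complex_of_real (f x))"

definition convolution_exists :: "(real \<Rightarrow> real) \<Rightarrow> (real \<Rightarrow> real) \<Rightarrow> real \<Rightarrow> bool" where
  "convolution_exists f g x \<longleftrightarrow> (\<lambda>t. f (x - t) * g t) integrable_on UNIV"

definition convolution :: "(real \<Rightarrow> real) \<Rightarrow> (real \<Rightarrow> real) \<Rightarrow> real \<Rightarrow> real" where
  "convolution f g x = integral UNIV (\<lambda>t. f (x - t) * g t)"

end

theory Submission
  imports Defs
begin

text \<open>
  Since \<open>exp (- i s x) = exp (- i s (x - t)) exp (- i s t)\<close>, the function
  \<open>exp (- i s x) (f \<star> g) x\<close> is the convolution of \<open>h x = exp (- i s x) f x\<close> and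
  \<open>k t = exp (- i s t) g t\<close>. Here \<open>h\<close> is integrable because the transform of \<open>f\<close>
  exists at \<open>s\<close>, and \<open>k\<close> is again in \<open>L\<^sup>1\<close> and of bounded variation
  (\<open>integrable_variation_imp_modulated_majorant\<close>): multiplying \<open>g\<close> by a bounded
  Lipschitz function yields a variation of at most a multiple of the variation of \<open>g\<close> plus the
  integral of \<open>\<bar>g\<bar>\<close>. So it suffices to show, for an
  integrable \<open>h\<close> and \<open>k\<close> in \<open>L\<^sup>1\<close> of bounded variation, that the integral of \<open>h \<star> k\<close>
  exists and is the product of the integrals of \<open>h\<close> and \<open>k\<close> (\<open>convolution_has_integral\<close>); the
  theorem follows from four real instances of this.

  The integral of \<open>h\<close> need not converge absolutely, so Fubini's theorem does not apply. It is
  avoided as follows. Let \<open>H\<close> be a primitive of \<open>h\<close>: it is bounded and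
  uniformly continuous, and it has limits at both ends of the line, whose difference is the integral
  of \<open>h\<close> (\<open>primitive_of_integrable\<close>). Then \<open>G = H \<star> k\<close> is an absolutely convergent
  convolution, and \<open>G' = h \<star> k\<close> everywhere. By the fundamental theorem of calculus the
  integral of \<open>h \<star> k\<close> over \<open>[a, b]\<close> is \<open>G b - G a\<close>, and dominated convergence gives the
  limits of \<open>G\<close> at both ends of the line as those of \<open>H\<close>, times the integral of \<open>k\<close>.

  Both the existence of \<open>h \<star> k\<close> and the formula \<open>G' = h \<star> k\<close> rest on one property of
  functions \<open>k\<close> of bounded variation: the integral of
  \<open>\<phi> k\<close> is at most a constant, depending on \<open>k\<close> only, times the supremum of
  \<open>\<bar>\<integral>\<phi>\<bar>\<close> over all compact intervals (\<open>bounded_variation_imp_multiplier_bound\<close>). This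
  is the second mean value theorem, applied to two monotone functions with difference \<open>k\<close>. For
  \<open>\<phi>\<close> take the difference quotient of \<open>H\<close> with step \<open>d\<close> minus \<open>h\<close>. Its
  integrals over compact intervals are differences of two values of the form \<open>H z - H u\<close>
  with \<open>\<bar>z - u\<bar> \<le> \<bar>d\<bar>\<close>, hence uniformly small with \<open>d\<close>.
\<close>

section \<open>Functions of bounded variation\<close>

text \<open>
  Bounded variation expressed by increments: \<open>W\<close> plays the role of the function that sends
  \<open>x\<close> to the variation of \<open>k\<close> on \<open>{..x}\<close>. Unlike suprema over partitions, such a bound is easily
  transferred to products, and both \<open>W\<close> and \<open>W - k\<close> are monotone, which is the
  Jordan decomposition.
\<close>

definition variation_majorant :: "(real \<Rightarrow> real) \<Rightarrow> (real \<Rightarrow> real) \<Rightarrow> bool" where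
  "variation_majorant W k \<longleftrightarrow>
     bounded (range W) \<and> (\<forall>x y. x \<le> y \<longrightarrow> \<bar>k y - k x\<bar> \<le> W y - W x)"

text \<open>
  The majorant is the variation on \<open>{..u}\<close>, i.e. the supremum of the sums over all increasing
  sequences ending at or before \<open>u\<close>. Such a sequence can be prolonged by the points \<open>u\<close> and
  \<open>v \<ge> u\<close>, which adds at least \<open>\<bar>g v - g u\<bar>\<close> to the sum.
\<close>

lemma bounded_variation_imp_majorant:
  assumes "bounded_variation g"
  obtains V where "variation_majorant V g"
proof -
  obtain M where M: "\<And>n (x :: nat \<Rightarrow> real). (\<forall>i<n. x i \<le> x (Suc i)) \<Longrightarrow>
      (\<Sum>i<n. \<bar>g (x (Suc i)) - g (x i)\<bar>) \<le> M"
    using assms unfolding bounded_variation_def by blast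
  define S where "S u = {(\<Sum>i<n. \<bar>g (x (Suc i)) - g (x i)\<bar>) | n x.
      (\<forall>i<n. x i \<le> x (Suc i)) \<and> x n \<le> u}" for u
  define V where "V u = Sup (S u)" for u
  have bdd: "bdd_above (S u)" for u
    unfolding S_def by (rule bdd_aboveI[of _ M]) (auto intro: M)
  have zero: "0 \<in> S u" for u
    unfolding S_def by (rule CollectI, rule exI[of _ 0], rule exI[of _ "\<lambda>_. u"]) simp
  have ext: "r + \<bar>g v - g u\<bar> \<le> V v" if "r \<in> S u" "u \<le> v" for r u v
  proof -
    obtain n x where x: "r = (\<Sum>i<n. \<bar>g (x (Suc i)) - g (x i)\<bar>)"
      "\<forall>i<n. x i \<le> x (Suc i)" "x n \<le> u"
      using \<open>r \<in> S u\<close> unfolding S_def by blast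
    define y where "y i = (if i \<le> n then x i else if i = Suc n then u else v)" for i
    have mono: "\<forall>i<n+2. y i \<le> y (Suc i)"
      using x \<open>u \<le> v\<close> by (auto simp: y_def less_Suc_eq)
    have "(\<Sum>i<n. \<bar>g (y (Suc i)) - g (y i)\<bar>) = r"
      unfolding x(1) by (rule sum.cong) (auto simp: y_def)
    hence "(\<Sum>i<n+2. \<bar>g (y (Suc i)) - g (y i)\<bar>) = r + \<bar>g u - g (x n)\<bar> + \<bar>g v - g u\<bar>"
      by (simp add: y_def)
    moreover have "(\<Sum>i<n+2. \<bar>g (y (Suc i)) - g (y i)\<bar>) \<in> S v"
      unfolding S_def mem_Collect_eq using mono \<open>u \<le> v\<close>
      by (intro exI[of _ "n+2"] exI[of _ y] conjI refl) (simp_all only: y_def, simp)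
    ultimately have "r + \<bar>g u - g (x n)\<bar> + \<bar>g v - g u\<bar> \<le> V v"
      unfolding V_def using bdd cSup_upper by metis
    thus ?thesis by linarith
  qed
  have incr: "\<bar>g v - g u\<bar> \<le> V v - V u" if "u \<le> v" for u v
  proof -
    have "V u \<le> V v - \<bar>g v - g u\<bar>"
      unfolding V_def[of u] using zero ext[OF _ that]
      by (intro cSup_least) (auto simp: le_diff_eq)
    thus ?thesis by linarith
  qed
  have "0 \<le> V u" for u
    unfolding V_def by (rule cSup_upper[OF zero bdd])
  moreover have "V u \<le> M" for u
    unfolding V_def using zero by (intro cSup_least) (auto simp: S_def intro: M)
  ultimately have "bounded (range V)"
    by (intro boundedI[of _ M]) auto
  with incr show thesis
    by (intro that[of V]) (auto simp: variation_majorant_def)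
qed

lemma variation_majorant_mono:
  assumes "variation_majorant W k" "x \<le> y"
  shows "W x \<le> W y"
  using assms unfolding variation_majorant_def by fastforce

lemma variation_majorant_bounded:
  assumes "variation_majorant W k"
  obtains M where "M \<ge> 0" "\<And>x. \<bar>W x\<bar> \<le> M" "\<And>x. \<bar>W x - k x\<bar> \<le> M"
proof -
  obtain B where B: "B > 0" "\<And>x. \<bar>W x\<bar> \<le> B"
    using assms unfolding variation_majorant_def bounded_pos by auto
  have *: "\<bar>k x - k 0\<bar> \<le> 2 * B" for x
  proof (cases "x \<le> 0")
    case True
    have "\<bar>k 0 - k x\<bar> \<le> W 0 - W x"
      using assms True unfolding variation_majorant_def by blast
    thus ?thesis using B(2)[of 0] B(2)[of x] by linarith
  next
    case False
    have "\<bar>k x - k 0\<bar> \<le> W x - W 0"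
      using assms False unfolding variation_majorant_def by simp
    thus ?thesis using B(2)[of 0] B(2)[of x] by linarith
  qed
  have "\<bar>W x - k x\<bar> \<le> 3 * B + \<bar>k 0\<bar>" for x
    using *[of x] B(2)[of x] by linarith
  moreover have "\<bar>W x\<bar> \<le> 3 * B + \<bar>k 0\<bar>" for x
    using B(2)[of x] B(1) by linarith
  ultimately show thesis
    using that[of "3 * B + \<bar>k 0\<bar>"] B(1) by simp
qed

section \<open>Henstock--Kurzweil integrals over the line\<close>

lemma ball_zero_subset_Icc_iff:
  fixes a b B :: real
  assumes "B > 0"
  shows "ball 0 B \<subseteq> {a..b} \<longleftrightarrow> a \<le> - B \<and> B \<le> b"
proof -
  have "ball 0 B = {-B<..<B}"
    by (simp add: ball_eq_greaterThanLessThan)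
  thus ?thesis
    using assms greaterThanLessThan_subseteq_atLeastAtMost_iff[of "-B" B a b] by auto
qed

text \<open>
  Hake's characterisation of the integral over the line, with the two end points of the
  interval made explicit.
\<close>

lemma has_integral_UNIV_real_iff:
  fixes h :: "real \<Rightarrow> real"
  shows "(h has_integral I) UNIV \<longleftrightarrow>
    (\<forall>a b. h integrable_on {a..b}) \<and>
    (\<forall>e>0. \<exists>B>0. \<forall>a b. a \<le> - B \<longrightarrow> B \<le> b \<longrightarrow> \<bar>integral {a..b} h - I\<bar> < e)"
  unfolding has_integral_alt'[of h I UNIV]
  by (simp add: ball_zero_subset_Icc_iff imp_conjL cong: conj_cong)

lemma abs_integral_UNIV_le:
  fixes h :: "real \<Rightarrow> real"
  assumes "h integrable_on UNIV" and bound: "\<And>a b. a \<le> b \<Longrightarrow> \<bar>integral {a..b} h\<bar> \<le> e"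
  shows "\<bar>integral UNIV h\<bar> \<le> e"
proof (rule field_le_epsilon)
  fix d :: real assume "d > 0"
  have "(h has_integral integral UNIV h) UNIV"
    using assms(1) by (rule integrable_integral)
  with \<open>d > 0\<close> obtain B where "B > 0" "\<bar>integral {-B..B} h - integral UNIV h\<bar> < d"
    unfolding has_integral_UNIV_real_iff by (metis order_refl)
  with bound[of "-B" B] show "\<bar>integral UNIV h\<bar> \<le> e + d"
    by linarith
qed

lemma integral_tail_small:
  fixes h :: "real \<Rightarrow> real"
  assumes "h integrable_on UNIV" "e > 0"
  obtains B where "B > 0"
    "\<And>c d. B \<le> c \<Longrightarrow> c \<le> d \<Longrightarrow> \<bar>integral {c..d} h\<bar> \<le> e"
    "\<And>c d. d \<le> - B \<Longrightarrow> c \<le> d \<Longrightarrow> \<bar>integral {c..d} h\<bar> \<le> e"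
proof -
  have "(h has_integral integral UNIV h) UNIV"
    using assms(1) by (rule integrable_integral)
  then obtain B where int: "\<And>a b. h integrable_on {a..b}" and "B > 0" and
    B: "\<And>a b. a \<le> - B \<Longrightarrow> B \<le> b \<Longrightarrow> \<bar>integral {a..b} h - integral UNIV h\<bar> < e / 2"
    unfolding has_integral_UNIV_real_iff using \<open>e > 0\<close> half_gt_zero by metis
  have "\<bar>integral {c..d} h\<bar> \<le> e" if "B \<le> c" "c \<le> d" for c d
  proof -
    have "integral {-B..c} h + integral {c..d} h = integral {-B..d} h"
      using that \<open>B > 0\<close> by (intro Henstock_Kurzweil_Integration.integral_combine int) auto
    moreover note B[of "-B" c] B[of "-B" d]
    ultimately show ?thesis using that \<open>B > 0\<close> by (simp; linarith)
  qed
  moreover have "\<bar>integral {c..d} h\<bar> \<le> e" if "d \<le> - B" "c \<le> d" for c d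
  proof -
    have "integral {c..d} h + integral {d..B} h = integral {c..B} h"
      using that \<open>B > 0\<close> by (intro Henstock_Kurzweil_Integration.integral_combine int) auto
    moreover note B[of c B] B[of d B]
    ultimately show ?thesis using that \<open>B > 0\<close> by (simp; linarith)
  qed
  ultimately show thesis
    using that \<open>B > 0\<close> by blast
qed

section \<open>Primitives\<close>

lemma primitive_exists:
  fixes h :: "real \<Rightarrow> real"
  assumes "\<And>a b. h integrable_on {a..b}"
  obtains H where "\<And>a b. a \<le> b \<Longrightarrow> (h has_integral (H b - H a)) {a..b}"
proof -
  define H where "H u = (if 0 \<le> u then integral {0..u} h else - integral {u..0} h)" for u
  have comb: "integral {a..c} h + integral {c..b} h = integral {a..b} h"
    if "a \<le> c" "c \<le> b" for a b c
    using that assms by (rule Henstock_Kurzweil_Integration.integral_combine)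
  have "integral {a..b} h = H b - H a" if "a \<le> b" for a b
    using comb[of a 0 b] comb[of 0 a b] comb[of a b 0] that by (auto simp: H_def)
  thus thesis
    using that assms by (metis integrable_integral)
qed

lemma primitive_continuous:
  fixes h H :: "real \<Rightarrow> real"
  assumes H: "\<And>a b. a \<le> b \<Longrightarrow> (h has_integral (H b - H a)) {a..b}"
  shows "continuous_on {a..b} H"
proof -
  have "continuous_on {a..b} (\<lambda>x. H a + integral {a..x} h)"
    using H by (intro continuous_intros indefinite_integral_continuous_1)
      (metis integrable_on_empty atLeastatMost_empty_iff has_integral_integrable)
  moreover have "H a + integral {a..x} h = H x" if "x \<in> {a..b}" for x
    using that integral_unique[OF H[of a x]] by auto
  ultimately show ?thesis
    by (rule continuous_on_eq)
qed

lemma primitive_of_continuous: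
  fixes f :: "real \<Rightarrow> real"
  assumes "continuous_on UNIV f"
  obtains F where "\<And>a b. a \<le> b \<Longrightarrow> (f has_integral (F b - F a)) {a..b}"
    "\<And>x. (F has_real_derivative f x) (at x)"
proof -
  have cont: "continuous_on S f" for S
    using assms continuous_on_subset by blast
  obtain F where F: "\<And>a b. a \<le> b \<Longrightarrow> (f has_integral (F b - F a)) {a..b}"
    using primitive_exists[of f] cont integrable_continuous_real by metis
  have "(F has_real_derivative f x) (at x)" for x
  proof -
    have "((\<lambda>u. F (x - 1) + integral {x-1..u} f) has_real_derivative f x) (at x within {x-1..x+1})"
      using integral_has_real_derivative[OF cont, of x "x-1" "x+1"]
      by (auto intro!: derivative_eq_intros)
    hence "((\<lambda>u. F (x - 1) + integral {x-1..u} f) has_real_derivative f x) (at x)"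
      by (simp add: at_within_Icc_at)
    thus ?thesis
    proof (rule has_field_derivative_transform_within_open[where S = "{x-1<..<x+1}"])
      show "F (x - 1) + integral {x-1..u} f = F u" if "u \<in> {x-1<..<x+1}" for u
        using that integral_unique[OF F[of "x-1" u]] by auto
    qed auto
  qed
  with F show thesis using that by blast
qed

lemma Cauchy_at_top_tendsto:
  fixes H :: "real \<Rightarrow> real"
  assumes "\<And>e. e > 0 \<Longrightarrow> \<exists>B. \<forall>u\<ge>B. \<forall>v\<ge>B. \<bar>H u - H v\<bar> \<le> e"
  obtains L where "(H \<longlongrightarrow> L) at_top"
proof -
  have "Cauchy (\<lambda>n. H (real n))"
  proof (rule metric_CauchyI)
    fix e :: real assume "e > 0"
    then obtain B where B: "\<And>u v. u \<ge> B \<Longrightarrow> v \<ge> B \<Longrightarrow> \<bar>H u - H v\<bar> \<le> e / 2"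
      using assms[of "e/2"] by auto
    show "\<exists>M. \<forall>m\<ge>M. \<forall>n\<ge>M. dist (H (real m)) (H (real n)) < e"
    proof (intro exI[of _ "nat \<lceil>B\<rceil>"] allI impI)
      fix m n :: nat assume "nat \<lceil>B\<rceil> \<le> m" "nat \<lceil>B\<rceil> \<le> n"
      hence "B \<le> real m" "B \<le> real n" by linarith+
      from B[OF this] \<open>e > 0\<close> show "dist (H (real m)) (H (real n)) < e"
        by (simp add: dist_real_def)
    qed
  qed
  then obtain L where L: "(\<lambda>n. H (real n)) \<longlonglongrightarrow> L"
    using Cauchy_convergent convergent_def by blast
  have "(H \<longlongrightarrow> L) at_top"
  proof (rule tendstoI)
    fix e :: real assume "e > 0"
    then obtain B where B: "\<And>u v. u \<ge> B \<Longrightarrow> v \<ge> B \<Longrightarrow> \<bar>H u - H v\<bar> \<le> e / 2"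
      using assms[of "e/2"] by auto
    have "eventually (\<lambda>n. dist (H (real n)) L < e / 2) sequentially"
      using tendstoD[OF L, of "e/2"] \<open>e > 0\<close> by simp
    moreover have "eventually (\<lambda>n. real n \<ge> B) sequentially"
      using filterlim_real_sequentially unfolding filterlim_at_top by blast
    ultimately have "eventually (\<lambda>n. dist (H (real n)) L < e / 2 \<and> real n \<ge> B) sequentially"
      by (rule eventually_conj)
    then obtain n where n: "dist (H (real n)) L < e / 2" "real n \<ge> B"
      using eventually_happens'[OF sequentially_bot] by blast
    show "eventually (\<lambda>u. dist (H u) L < e) at_top"
      using eventually_ge_at_top[of B]
    proof eventually_elim
      case (elim u)
      from B[OF this n(2)] n(1) show ?case
        unfolding dist_real_def by linarith
    qed
  qed
  thus thesis by (rule that)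
qed

text \<open>
  By the Cauchy criterion, \<open>H\<close> varies little beyond some \<open>B\<close> on either side. This
  gives the limits at both ends; with continuity on a compact interval it also gives boundedness and
  uniform continuity.
\<close>

lemma primitive_of_integrable:
  fixes h :: "real \<Rightarrow> real"
  assumes h: "h integrable_on UNIV"
  obtains H L\<^sub>0 L\<^sub>1 where "\<And>a b. a \<le> b \<Longrightarrow> (h has_integral (H b - H a)) {a..b}"
    "uniformly_continuous_on UNIV H" "bounded (range H)"
    "(H \<longlongrightarrow> L\<^sub>0) at_bot" "(H \<longlongrightarrow> L\<^sub>1) at_top" "integral UNIV h = L\<^sub>1 - L\<^sub>0"
proof -
  have hI: "(h has_integral integral UNIV h) UNIV"
    using h by (rule integrable_integral)
  have "h integrable_on {a..b}" for a b
    using hI unfolding has_integral_UNIV_real_iff by blast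
  then obtain H where H: "\<And>a b. a \<le> b \<Longrightarrow> (h has_integral (H b - H a)) {a..b}"
    using primitive_exists by blast
  have tails: "\<exists>B>0. (\<forall>u\<ge>B. \<forall>v\<ge>B. \<bar>H u - H v\<bar> \<le> e) \<and> (\<forall>u\<le>-B. \<forall>v\<le>-B. \<bar>H u - H v\<bar> \<le> e)"
    if "e > 0" for e
  proof -
    obtain B where "B > 0" and
      B: "\<And>c d. B \<le> c \<Longrightarrow> c \<le> d \<Longrightarrow> \<bar>integral {c..d} h\<bar> \<le> e"
         "\<And>c d. d \<le> - B \<Longrightarrow> c \<le> d \<Longrightarrow> \<bar>integral {c..d} h\<bar> \<le> e"
      using integral_tail_small[OF h \<open>e > 0\<close>] by blast
    have "\<bar>H u - H v\<bar> \<le> e" if "u \<ge> B \<and> v \<ge> B \<or> u \<le> - B \<and> v \<le> - B" for u v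
      using that B[of u v] B[of v u] integral_unique[OF H[of u v]] integral_unique[OF H[of v u]]
      by (cases "u \<le> v") (auto simp: abs_minus_commute)
    with \<open>B > 0\<close> show ?thesis by blast
  qed
  obtain L\<^sub>1 where L1: "(H \<longlongrightarrow> L\<^sub>1) at_top"
    using Cauchy_at_top_tendsto[of H] tails by metis
  have "\<exists>B. \<forall>u\<ge>B. \<forall>v\<ge>B. \<bar>H (-u) - H (-v)\<bar> \<le> e" if e: "e > 0" for e
    using tails[OF e] by (metis neg_le_iff_le)
  then obtain L\<^sub>0 where "((\<lambda>u. H (- u)) \<longlongrightarrow> L\<^sub>0) at_top"
    using Cauchy_at_top_tendsto[of "\<lambda>u. H (- u)"] by blast
  hence L0: "(H \<longlongrightarrow> L\<^sub>0) at_bot"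
    by (simp add: filterlim_at_bot_mirror)
  have cont: "continuous_on {a..b} H" for a b
    using H by (rule primitive_continuous)
  have uc: "uniformly_continuous_on UNIV H"
    unfolding uniformly_continuous_on_def
  proof (intro allI impI)
    fix e :: real assume "e > 0"
    then obtain B where "B > 0" and B: "\<And>u v. u \<ge> B \<Longrightarrow> v \<ge> B \<Longrightarrow> \<bar>H u - H v\<bar> \<le> e / 2"
        "\<And>u v. u \<le> - B \<Longrightarrow> v \<le> - B \<Longrightarrow> \<bar>H u - H v\<bar> \<le> e / 2"
      using tails[of "e/2"] by auto
    (* The compact interval overlaps both tails by 1, so that points at distance less than 1
       lie together in one of the three pieces. *)
    have "uniformly_continuous_on {-B-1..B+1} H"
      using cont by (intro compact_uniformly_continuous) auto
    then obtain d where "d > 0" and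
      d: "\<And>u v. u \<in> {-B-1..B+1} \<Longrightarrow> v \<in> {-B-1..B+1} \<Longrightarrow> dist v u < d \<Longrightarrow> dist (H v) (H u) < e"
      using \<open>e > 0\<close> unfolding uniformly_continuous_on_def by metis
    show "\<exists>d>0. \<forall>u\<in>UNIV. \<forall>v\<in>UNIV. dist v u < d \<longrightarrow> dist (H v) (H u) < e"
    proof (intro exI[of _ "min d 1"] conjI ballI impI)
      fix u v :: real assume uv: "dist v u < min d 1"
      consider "u \<in> {-B-1..B+1} \<and> v \<in> {-B-1..B+1}" | "u \<ge> B \<and> v \<ge> B" | "u \<le> - B \<and> v \<le> - B"
        using uv \<open>B > 0\<close> by (simp add: dist_real_def) linarith
      thus "dist (H v) (H u) < e"
      proof cases
        case 1
        with d uv show ?thesis by simp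
      next
        case 2
        with B(1)[of v u] \<open>e > 0\<close> show ?thesis by (simp add: dist_real_def)
      next
        case 3
        with B(2)[of v u] \<open>e > 0\<close> show ?thesis by (simp add: dist_real_def)
      qed
    qed (use \<open>d > 0\<close> in simp)
  qed
  have bdd: "bounded (range H)"
  proof -
    obtain B where "B > 0" and B: "\<And>u v. u \<ge> B \<Longrightarrow> v \<ge> B \<Longrightarrow> \<bar>H u - H v\<bar> \<le> 1"
        "\<And>u v. u \<le> - B \<Longrightarrow> v \<le> - B \<Longrightarrow> \<bar>H u - H v\<bar> \<le> 1"
      using tails[of 1] by auto
    have "bounded (H ` {-B..B})"
      using cont by (intro compact_imp_bounded compact_continuous_image) auto
    then obtain C where C: "\<And>u. u \<in> {-B..B} \<Longrightarrow> \<bar>H u\<bar> \<le> C"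
      unfolding bounded_iff by force
    have "\<bar>H u\<bar> \<le> C + 1" for u
    proof -
      consider "u \<in> {-B..B}" | "u \<ge> B" | "u \<le> - B" by fastforce
      thus ?thesis
        using C[of u] C[of B] C[of "-B"] B(1)[of u B] B(2)[of u "-B"] \<open>B > 0\<close>
        by cases auto
    qed
    thus ?thesis by (intro boundedI[of _ "C + 1"]) auto
  qed
  have "integral UNIV h = L\<^sub>1 - L\<^sub>0"
  proof (rule LIMSEQ_unique)
    have "((\<lambda>b. H b - H (- b)) \<longlongrightarrow> L\<^sub>1 - L\<^sub>0) at_top"
      using L0 L1 by (auto intro!: tendsto_diff simp: filterlim_at_bot_mirror)
    thus "(\<lambda>n. H (real n) - H (- real n)) \<longlonglongrightarrow> L\<^sub>1 - L\<^sub>0"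
      by (rule filterlim_compose[OF _ filterlim_real_sequentially])
    show "(\<lambda>n. H (real n) - H (- real n)) \<longlonglongrightarrow> integral UNIV h"
    proof (rule LIMSEQ_I)
      fix e :: real assume "e > 0"
      then obtain B where "B > 0" and
        B: "\<And>a b. a \<le> - B \<Longrightarrow> B \<le> b \<Longrightarrow> \<bar>integral {a..b} h - integral UNIV h\<bar> < e"
        using hI unfolding has_integral_UNIV_real_iff by blast
      show "\<exists>no. \<forall>n\<ge>no. norm (H (real n) - H (- real n) - integral UNIV h) < e"
      proof (intro exI[of _ "nat \<lceil>B\<rceil>"] allI impI)
        fix n :: nat assume "nat \<lceil>B\<rceil> \<le> n"
        hence "B \<le> real n" by linarith
        thus "norm (H (real n) - H (- real n) - integral UNIV h) < e"
          using B[of "- real n" "real n"] integral_unique[OF H[of "- real n" "real n"]] by simp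
      qed
    qed
  qed
  with H uc bdd L0 L1 show thesis using that by blast
qed

lemma has_integral_reflect_shift:
  fixes h H :: "real \<Rightarrow> real"
  assumes H: "\<And>a b. a \<le> b \<Longrightarrow> (h has_integral (H b - H a)) {a..b}" and "a \<le> b"
  shows "((\<lambda>t. h (x - t)) has_integral (H (x - a) - H (x - b))) {a..b}"
proof -
  have "((h \<circ> (+) x) has_integral (H (x - a) - H (x - b))) {-b..-a}"
    unfolding has_integral_shift_Icc_real using H[of "x - b" "x - a"] \<open>a \<le> b\<close> by simp
  hence "((\<lambda>t. (h \<circ> (+) x) (- t)) has_integral (H (x - a) - H (x - b))) {-(-a)..-(-b)}"
    by (simp only: has_integral_reflect_real)
  thus ?thesis by (simp add: o_def)
qed

lemma integrable_reflect_shift: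
  fixes h :: "real \<Rightarrow> real"
  assumes "h integrable_on UNIV"
  shows "(\<lambda>t. h (x - t)) integrable_on UNIV"
proof -
  have hI: "(h has_integral integral UNIV h) UNIV"
    using assms by (rule integrable_integral)
  have "h integrable_on {a..b}" for a b
    using hI unfolding has_integral_UNIV_real_iff by blast
  then obtain H where H: "\<And>a b. a \<le> b \<Longrightarrow> (h has_integral (H b - H a)) {a..b}"
    using primitive_exists by blast
  have "((\<lambda>t. h (x - t)) has_integral integral UNIV h) UNIV"
    unfolding has_integral_UNIV_real_iff
  proof (intro conjI allI impI)
    fix a b :: real
    show "(\<lambda>t. h (x - t)) integrable_on {a..b}"
    proof (cases "a \<le> b")
      case True
      from has_integral_reflect_shift[OF H True] show ?thesis by blast
    qed (simp add: integrable_on_empty)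
  next
    fix e :: real assume "e > 0"
    then obtain B where "B > 0" and
      B: "\<And>a b. a \<le> - B \<Longrightarrow> B \<le> b \<Longrightarrow> \<bar>integral {a..b} h - integral UNIV h\<bar> < e"
      using hI unfolding has_integral_UNIV_real_iff by blast
    show "\<exists>B>0. \<forall>a b. a \<le> - B \<longrightarrow> B \<le> b \<longrightarrow>
        \<bar>integral {a..b} (\<lambda>t. h (x - t)) - integral UNIV h\<bar> < e"
    proof (intro exI[of _ "B + \<bar>x\<bar>"] conjI allI impI)
      fix a b assume ab: "a \<le> - (B + \<bar>x\<bar>)" "B + \<bar>x\<bar> \<le> b"
      hence "a \<le> b" "x - b \<le> - B" "B \<le> x - a" "x - b \<le> x - a"
        using \<open>B > 0\<close> by linarith+
      thus "\<bar>integral {a..b} (\<lambda>t. h (x - t)) - integral UNIV h\<bar> < e"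
        using B[of "x - b" "x - a"] integral_unique[OF H[of "x - b" "x - a"]]
          integral_unique[OF has_integral_reflect_shift[OF H, of a b x]] by simp
    qed (use \<open>B > 0\<close> in auto)
  qed
  thus ?thesis by blast
qed

section \<open>Multipliers of bounded variation\<close>

text \<open>
  By the second mean value theorem the integral equals \<open>p a\<close> times the integral of
  \<open>\<phi>\<close> over \<open>{a..c}\<close> plus \<open>p b\<close> times its integral over \<open>{c..b}\<close>, for some \<open>c\<close>.
\<close>

lemma bounded_monotone_multiplier:
  fixes p \<phi> :: "real \<Rightarrow> real"
  assumes "a \<le> b" "\<phi> integrable_on {a..b}" and p: "\<And>x y. x \<le> y \<Longrightarrow> p x \<le> p y"
    and M: "\<And>x. \<bar>p x\<bar> \<le> M"
    and bound: "\<And>c d. a \<le> c \<Longrightarrow> c \<le> d \<Longrightarrow> d \<le> b \<Longrightarrow> \<bar>integral {c..d} \<phi>\<bar> \<le> e"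
  shows "(\<lambda>x. p x * \<phi> x) integrable_on {a..b}"
    and "\<bar>integral {a..b} (\<lambda>x. p x * \<phi> x)\<bar> \<le> 2 * M * e"
proof -
  obtain c where c: "c \<in> {a..b}" and I:
    "((\<lambda>x. p x * \<phi> x) has_integral (p a * integral {a..c} \<phi> + p b * integral {c..b} \<phi>)) {a..b}"
    using second_mean_value_theorem_full[of \<phi> a b p] assms by metis
  from I show "(\<lambda>x. p x * \<phi> x) integrable_on {a..b}" by blast
  have "0 \<le> M" using M[of 0] by linarith
  have "\<bar>p a * integral {a..c} \<phi>\<bar> \<le> M * e" "\<bar>p b * integral {c..b} \<phi>\<bar> \<le> M * e"
    unfolding abs_mult using c M bound \<open>0 \<le> M\<close> by (auto intro!: mult_mono)
  thus "\<bar>integral {a..b} (\<lambda>x. p x * \<phi> x)\<bar> \<le> 2 * M * e"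
    unfolding integral_unique[OF I] by linarith
qed

text \<open>
  The supremum of \<open>\<bar>integral {c..d} \<phi>\<bar>\<close> is the Alexiewicz norm of \<open>\<phi>\<close>. The
  following says that integration against \<open>k\<close> is bounded by \<open>C\<close> in this norm, on every compact
  interval.
\<close>

definition multiplier_bound :: "real \<Rightarrow> (real \<Rightarrow> real) \<Rightarrow> bool" where
  "multiplier_bound C k \<longleftrightarrow> C > 0 \<and>
     (\<forall>a b \<phi> e. a \<le> b \<longrightarrow> \<phi> integrable_on {a..b} \<longrightarrow>
       (\<forall>c d. a \<le> c \<longrightarrow> c \<le> d \<longrightarrow> d \<le> b \<longrightarrow> \<bar>integral {c..d} \<phi>\<bar> \<le> e) \<longrightarrow>
       (\<lambda>x. \<phi> x * k x) integrable_on {a..b} \<and> \<bar>integral {a..b} (\<lambda>x. \<phi> x * k x)\<bar> \<le> C * e)"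

lemma multiplier_boundD:
  assumes "multiplier_bound C k" "a \<le> b" "\<phi> integrable_on {a..b}"
    and "\<And>c d. a \<le> c \<Longrightarrow> c \<le> d \<Longrightarrow> d \<le> b \<Longrightarrow> \<bar>integral {c..d} \<phi>\<bar> \<le> e"
  shows "(\<lambda>x. \<phi> x * k x) integrable_on {a..b}"
    and "\<bar>integral {a..b} (\<lambda>x. \<phi> x * k x)\<bar> \<le> C * e"
  using assms unfolding multiplier_bound_def by blast+

lemma bounded_variation_imp_multiplier_bound:
  assumes "variation_majorant W k"
  obtains C where "multiplier_bound C k"
proof -
  obtain M where "M \<ge> 0" and M: "\<And>x. \<bar>W x\<bar> \<le> M" "\<And>x. \<bar>W x - k x\<bar> \<le> M"
    using variation_majorant_bounded[OF assms] by blast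
  have mono1: "W x \<le> W y" if "x \<le> y" for x y
    using variation_majorant_mono[OF assms that] .
  have mono2: "W x - k x \<le> W y - k y" if "x \<le> y" for x y
    using assms that unfolding variation_majorant_def by (smt (verit))
  have "(\<lambda>x. \<phi> x * k x) integrable_on {a..b} \<and>
      \<bar>integral {a..b} (\<lambda>x. \<phi> x * k x)\<bar> \<le> (4 * M + 1) * e"
    if ab: "a \<le> b" and \<phi>: "\<phi> integrable_on {a..b}" and
      bound': "\<forall>c d. a \<le> c \<longrightarrow> c \<le> d \<longrightarrow> d \<le> b \<longrightarrow> \<bar>integral {c..d} \<phi>\<bar> \<le> e"
    for a b e and \<phi> :: "real \<Rightarrow> real"
  proof -
    have bound: "\<bar>integral {c..d} \<phi>\<bar> \<le> e" if "a \<le> c" "c \<le> d" "d \<le> b" for c d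
      using bound' that by blast
    note 1 = bounded_monotone_multiplier[of a b \<phi> W M e, OF ab \<phi> mono1 M(1) bound]
    note 2 = bounded_monotone_multiplier[of a b \<phi> "\<lambda>x. W x - k x" M e, OF ab \<phi> mono2 M(2) bound]
    have eq: "(\<lambda>x. \<phi> x * k x) = (\<lambda>x. W x * \<phi> x - (W x - k x) * \<phi> x)"
      by (auto simp: algebra_simps)
    have "(\<lambda>x. \<phi> x * k x) integrable_on {a..b}"
      unfolding eq using 1(1) 2(1) by (rule integrable_diff)
    moreover have "integral {a..b} (\<lambda>x. \<phi> x * k x) =
        integral {a..b} (\<lambda>x. W x * \<phi> x) - integral {a..b} (\<lambda>x. (W x - k x) * \<phi> x)"
      unfolding eq using 1(1) 2(1) by (rule Henstock_Kurzweil_Integration.integral_diff)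
    moreover have "0 \<le> e" using bound[of a a] ab by simp
    moreover have "(4 * M + 1) * e = 2 * M * e + 2 * M * e + e"
      by (simp add: algebra_simps)
    ultimately show ?thesis
      using 1(2) 2(2) by linarith
  qed
  (* The summand 1 makes the constant positive also for M = 0. *)
  with \<open>M \<ge> 0\<close> have "multiplier_bound (4 * M + 1) k"
    unfolding multiplier_bound_def by simp
  thus thesis by (rule that)
qed

text \<open>
  The Alexiewicz norm of \<open>\<phi>\<close> on the complement of a large interval is small; so is the
  integral of \<open>\<phi> k\<close> there, which is the Cauchy criterion.
\<close>

lemma integrable_bounded_variation_product:
  assumes "variation_majorant W k" and \<phi>: "\<phi> integrable_on UNIV"
  shows "(\<lambda>x. \<phi> x * k x) integrable_on UNIV"
proof -
  obtain C where C: "multiplier_bound C k"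
    using bounded_variation_imp_multiplier_bound[OF assms(1)] .
  have "C > 0" using C by (simp add: multiplier_bound_def)
  obtain H L\<^sub>0 L\<^sub>1 where H: "\<And>a b. a \<le> b \<Longrightarrow> (\<phi> has_integral (H b - H a)) {a..b}"
    and bH: "bounded (range H)"
    using primitive_of_integrable[OF \<phi>] by metis
  have int\<phi>: "\<phi> integrable_on {a..b}" for a b
    using H[of a b] by (cases "a \<le> b") auto
  obtain D where D: "\<And>u. \<bar>H u\<bar> \<le> D"
    using bH unfolding bounded_iff by auto
  have bound: "\<bar>integral {c..d} \<phi>\<bar> \<le> 2 * D" if "c \<le> d" for c d
    unfolding integral_unique[OF H[OF that]] using D[of c] D[of d] by linarith
  have int: "(\<lambda>x. \<phi> x * k x) integrable_on {a..b}" for a b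
  proof (cases "a \<le> b")
    case True
    show ?thesis
      by (rule multiplier_boundD(1)[OF C True int\<phi> bound])
  qed (simp add: integrable_on_empty)
  show ?thesis
  proof (subst integrable_alt_subset, intro conjI allI impI)
    fix a b show "(\<lambda>x. if x \<in> UNIV then \<phi> x * k x else 0) integrable_on cbox a b"
      using int by simp
  next
    fix e :: real assume "e > 0"
    define e' where "e' = e / (4 * C)"
    have "e' > 0" using \<open>e > 0\<close> \<open>C > 0\<close> by (simp add: e'_def)
    obtain B where "B > 0" and
      B: "\<And>c d. B \<le> c \<Longrightarrow> c \<le> d \<Longrightarrow> \<bar>integral {c..d} \<phi>\<bar> \<le> e'"
         "\<And>c d. d \<le> - B \<Longrightarrow> c \<le> d \<Longrightarrow> \<bar>integral {c..d} \<phi>\<bar> \<le> e'"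
      using integral_tail_small[OF \<phi> \<open>e' > 0\<close>] by blast
    have *: "\<bar>integral {a..b} (\<lambda>x. \<phi> x * k x) - integral {c..d} (\<lambda>x. \<phi> x * k x)\<bar> < e"
      if "a \<le> - B" "B \<le> b" "c \<le> a" "b \<le> d" for a b c d
    proof -
      have "integral {c..a} (\<lambda>x. \<phi> x * k x) + integral {a..d} (\<lambda>x. \<phi> x * k x) =
          integral {c..d} (\<lambda>x. \<phi> x * k x)"
        using that \<open>B > 0\<close> by (intro Henstock_Kurzweil_Integration.integral_combine int) auto
      moreover have "integral {a..b} (\<lambda>x. \<phi> x * k x) + integral {b..d} (\<lambda>x. \<phi> x * k x) =
          integral {a..d} (\<lambda>x. \<phi> x * k x)"
        using that \<open>B > 0\<close> by (intro Henstock_Kurzweil_Integration.integral_combine int) auto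
      moreover have "\<bar>integral {c..a} (\<lambda>x. \<phi> x * k x)\<bar> \<le> C * e'"
        using that by (intro multiplier_boundD(2)[OF C] int\<phi> B(2)) auto
      moreover have "\<bar>integral {b..d} (\<lambda>x. \<phi> x * k x)\<bar> \<le> C * e'"
        using that by (intro multiplier_boundD(2)[OF C] int\<phi> B(1)) auto
      moreover have "C * e' = e / 4"
        using \<open>C > 0\<close> by (simp add: e'_def)
      ultimately show ?thesis using \<open>e > 0\<close> by linarith
    qed
    show "\<exists>B>0. \<forall>a b c d. ball 0 B \<subseteq> cbox a b \<and> cbox a b \<subseteq> cbox c d \<longrightarrow>
        norm (integral (cbox a b) (\<lambda>x. if x \<in> UNIV then \<phi> x * k x else 0) -
          integral (cbox c d) (\<lambda>x. if x \<in> UNIV then \<phi> x * k x else 0)) < e"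
      using * \<open>B > 0\<close> by (intro exI[of _ B]) (auto simp: ball_zero_subset_Icc_iff)
  qed
qed

section \<open>Integrating a convolution\<close>

lemma absolutely_integrable_bounded_continuous_product:
  fixes H k :: "real \<Rightarrow> real"
  assumes "continuous_on UNIV H" "bounded (range H)" "k absolutely_integrable_on UNIV"
  shows "(\<lambda>t. H t * k t) absolutely_integrable_on UNIV"
  using assms continuous_imp_measurable_on_sets_lebesgue[of UNIV H]
  by (intro absolutely_integrable_bounded_measurable_product_real) auto

text \<open>
  The proof differentiates \<open>G = H \<star> k\<close>, where \<open>H\<close> is a primitive of \<open>h\<close>, under the
  integral sign; \<open>H \<star> k\<close> converges absolutely, while \<open>h \<star> k\<close> need not.
\<close>

lemma convolution_has_integral:
  fixes h k :: "real \<Rightarrow> real"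
  assumes h: "h integrable_on UNIV" and k: "k absolutely_integrable_on UNIV"
    and W: "variation_majorant W k"
  shows "((\<lambda>x. integral UNIV (\<lambda>t. h (x - t) * k t)) has_integral
            (integral UNIV h * integral UNIV k)) UNIV"
proof -
  obtain H L\<^sub>0 L\<^sub>1 where H: "\<And>a b. a \<le> b \<Longrightarrow> (h has_integral (H b - H a)) {a..b}"
    and uc: "uniformly_continuous_on UNIV H" and bH: "bounded (range H)"
    and L0: "(H \<longlongrightarrow> L\<^sub>0) at_bot" and L1: "(H \<longlongrightarrow> L\<^sub>1) at_top"
    and Ih: "integral UNIV h = L\<^sub>1 - L\<^sub>0"
    using primitive_of_integrable[OF h] by metis
  have cH: "continuous_on UNIV H"
    using uc by (rule uniformly_continuous_imp_continuous)
  obtain P where P: "\<And>a b. a \<le> b \<Longrightarrow> (H has_integral (P b - P a)) {a..b}"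
    "\<And>x. (P has_real_derivative H x) (at x)"
    using primitive_of_continuous[OF cH] by blast
  obtain D where D: "\<And>u. \<bar>H u\<bar> \<le> D"
    using bH unfolding bounded_iff by auto
  obtain C where C: "multiplier_bound C k"
    using bounded_variation_imp_multiplier_bound[OF W] .
  have "C > 0" using C by (simp add: multiplier_bound_def)
  define conv where "conv x = integral UNIV (\<lambda>t. h (x - t) * k t)" for x
  define G where "G x = integral UNIV (\<lambda>t. H (x - t) * k t)" for x
  have intH: "(\<lambda>t. H (x - t) * k t) integrable_on UNIV" for x
  proof -
    have "continuous_on UNIV (\<lambda>t. H (x - t))"
      by (rule continuous_on_compose2[OF cH]) (auto intro!: continuous_intros)
    moreover have "bounded (range (\<lambda>t. H (x - t)))"
      using D by (intro boundedI[of _ D]) auto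
    ultimately show ?thesis
      using k absolutely_integrable_bounded_continuous_product
      by (blast intro: set_lebesgue_integral_eq_integral(1))
  qed
  have inth: "(\<lambda>t. h (x - t) * k t) integrable_on UNIV" for x
    using integrable_bounded_variation_product[OF W integrable_reflect_shift[OF h]] .

  (* The difference quotient of G minus h * k is the integral of \<phi> against k. A primitive of
     \<phi> is, up to sign and reflection, \<Phi>, and \<Phi> is small by the mean value theorem for the primitive
     P of H. *)
  have quotient: "\<bar>(G (x + d) - G x) / d - conv x\<bar> \<le> C * (2 * e)"
    if "d \<noteq> 0" and e: "\<And>u v. \<bar>u - v\<bar> \<le> \<bar>d\<bar> \<Longrightarrow> \<bar>H u - H v\<bar> \<le> e" for x d e
  proof -
    define \<phi> where "\<phi> t = (H (x + d - t) - H (x - t)) / d - h (x - t)" for t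
    define \<Phi> where "\<Phi> u = (P (u + d) - P u) / d - H u" for u
    have \<Phi>: "\<bar>\<Phi> u\<bar> \<le> e" for u
    proof -
      obtain z where z: "\<bar>z - u\<bar> \<le> \<bar>d\<bar>" "(P (u + d) - P u) / d = H z"
      proof (cases "d > 0")
        case True
        then obtain z where "u < z" "z < u + d" "P (u + d) - P u = (u + d - u) * H z"
          using MVT2[of u "u + d" P H] P(2) by auto
        thus thesis using True by (intro that[of z]) auto
      next
        case False
        then obtain z where "u + d < z" "z < u" "P u - P (u + d) = (u - (u + d)) * H z"
          using MVT2[of "u + d" u P H] P(2) \<open>d \<noteq> 0\<close> by auto
        thus thesis using False \<open>d \<noteq> 0\<close> by (intro that[of z]) (auto simp: field_simps)
      qed
      with e show ?thesis by (simp add: \<Phi>_def)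
    qed
    have int\<phi>: "(\<phi> has_integral (\<Phi> (x - a) - \<Phi> (x - b))) {a..b}" if "a \<le> b" for a b
    proof -
      have "(\<phi> has_integral (((P (x + d - a) - P (x + d - b)) - (P (x - a) - P (x - b))) / d
          - (H (x - a) - H (x - b)))) {a..b}"
        unfolding \<phi>_def
        using has_integral_reflect_shift[OF P(1) that] has_integral_reflect_shift[OF H that]
        by (intro has_integral_diff has_integral_divide) auto
      moreover have "((P (x + d - a) - P (x + d - b)) - (P (x - a) - P (x - b))) / d
          - (H (x - a) - H (x - b)) = \<Phi> (x - a) - \<Phi> (x - b)"
        by (simp add: \<Phi>_def diff_divide_distrib add_divide_distrib algebra_simps)
      ultimately show ?thesis by simp
    qed
    have prod: "((\<lambda>t. \<phi> t * k t) has_integral ((G (x + d) - G x) / d - conv x)) UNIV"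
    proof -
      have "((\<lambda>t. (H (x + d - t) * k t - H (x - t) * k t) / d - h (x - t) * k t)
          has_integral ((G (x + d) - G x) / d - conv x)) UNIV"
        unfolding G_def conv_def
        by (intro has_integral_diff has_integral_divide integrable_integral intH inth)
      thus ?thesis
        by (rule has_integral_eq[rotated]) (simp add: \<phi>_def field_simps)
    qed
    have "\<bar>integral UNIV (\<lambda>t. \<phi> t * k t)\<bar> \<le> C * (2 * e)"
    proof (rule abs_integral_UNIV_le)
      show "(\<lambda>t. \<phi> t * k t) integrable_on UNIV" using prod by blast
      fix a b :: real assume "a \<le> b"
      have "\<bar>integral {c..d} \<phi>\<bar> \<le> 2 * e" if "c \<le> d" for c d
        using integral_unique[OF int\<phi>[OF that]] \<Phi>[of "x - c"] \<Phi>[of "x - d"] by linarith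
      thus "\<bar>integral {a..b} (\<lambda>t. \<phi> t * k t)\<bar> \<le> C * (2 * e)"
        using int\<phi>[OF \<open>a \<le> b\<close>] by (intro multiplier_boundD(2)[OF C \<open>a \<le> b\<close>]) auto
    qed
    thus ?thesis using integral_unique[OF prod] by simp
  qed

  have deriv: "(G has_real_derivative conv x) (at x)" for x
    unfolding DERIV_def
  proof (rule LIM_I)
    fix r :: real assume "r > 0"
    define e where "e = r / (4 * C)"
    have "e > 0" using \<open>r > 0\<close> \<open>C > 0\<close> by (simp add: e_def)
    then obtain \<delta> where "\<delta> > 0" and \<delta>: "\<And>u v. dist v u < \<delta> \<Longrightarrow> dist (H v) (H u) < e"
      using uc unfolding uniformly_continuous_on_def by blast
    have "C * (2 * e) < r" using \<open>C > 0\<close> \<open>r > 0\<close> by (simp add: e_def)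
    show "\<exists>s>0. \<forall>d. d \<noteq> 0 \<and> norm (d - 0) < s \<longrightarrow> norm ((G (x + d) - G x) / d - conv x) < r"
    proof (intro exI[of _ \<delta>] conjI allI impI)
      fix d :: real assume d: "d \<noteq> 0 \<and> norm (d - 0) < \<delta>"
      have "\<bar>H u - H v\<bar> \<le> e" if "\<bar>u - v\<bar> \<le> \<bar>d\<bar>" for u v
        using \<delta>[of u v] that d by (simp add: dist_real_def)
      with quotient[of d e x] d \<open>C * (2 * e) < r\<close>
      show "norm ((G (x + d) - G x) / d - conv x) < r" by simp
    qed (fact \<open>\<delta> > 0\<close>)
  qed
  have FTC: "(conv has_integral (G b - G a)) {a..b}" if "a \<le> b" for a b
    using that deriv
    by (intro fundamental_theorem_of_calculus)
       (auto simp: has_real_derivative_iff_has_vector_derivative[symmetric]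
             intro: has_field_derivative_at_within)

  have limit: "(\<lambda>n. G (X n)) \<longlonglongrightarrow> L * integral UNIV k"
    if X: "\<And>t. (\<lambda>n. H (X n - t)) \<longlonglongrightarrow> L" for X :: "nat \<Rightarrow> real" and L
  proof -
    have "(\<lambda>n. integral UNIV (\<lambda>t. H (X n - t) * k t)) \<longlonglongrightarrow> integral UNIV (\<lambda>t. L * k t)"
    proof (rule dominated_convergence(2)[where h = "\<lambda>t. D * \<bar>k t\<bar>"])
      show "(\<lambda>t. D * \<bar>k t\<bar>) integrable_on UNIV"
        using k by (intro integrable_on_mult_right) (simp add: absolutely_integrable_on_def)
      show "norm (H (X n - t) * k t) \<le> D * \<bar>k t\<bar>" for n t
        using D by (simp add: abs_mult mult_right_mono)
      show "(\<lambda>n. H (X n - t) * k t) \<longlonglongrightarrow> L * k t" for t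
        by (intro tendsto_intros X)
    qed (fact intH)
    thus ?thesis by (simp add: G_def)
  qed
  have G1: "(G \<longlongrightarrow> L\<^sub>1 * integral UNIV k) at_top"
  proof (rule tendsto_at_topI_sequentially, rule limit)
    fix X :: "nat \<Rightarrow> real" and t assume "filterlim X at_top sequentially"
    hence "filterlim (\<lambda>n. - t + X n) at_top sequentially"
      by (intro filterlim_tendsto_add_at_top[OF tendsto_const])
    hence "filterlim (\<lambda>n. X n - t) at_top sequentially"
      by simp
    thus "(\<lambda>n. H (X n - t)) \<longlonglongrightarrow> L\<^sub>1"
      by (rule filterlim_compose[OF L1])
  qed
  have G0: "(G \<longlongrightarrow> L\<^sub>0 * integral UNIV k) at_bot"
  proof (rule tendsto_at_botI_sequentially, rule limit)
    fix X :: "nat \<Rightarrow> real" and t assume "filterlim X at_bot sequentially"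
    hence "filterlim (\<lambda>n. t + - X n) at_top sequentially"
      by (intro filterlim_tendsto_add_at_top[OF tendsto_const]) (simp add: filterlim_uminus_at_top)
    hence "filterlim (\<lambda>n. X n - t) at_bot sequentially"
      by (simp add: filterlim_uminus_at_bot)
    thus "(\<lambda>n. H (X n - t)) \<longlonglongrightarrow> L\<^sub>0"
      by (rule filterlim_compose[OF L0])
  qed
  have "(conv has_integral (integral UNIV h * integral UNIV k)) UNIV"
    unfolding has_integral_UNIV_real_iff
  proof (intro conjI allI impI)
    fix a b show "conv integrable_on {a..b}"
      using FTC[of a b] by (cases "a \<le> b") auto
  next
    fix e :: real assume "e > 0"
    hence "eventually (\<lambda>b. dist (G b) (L\<^sub>1 * integral UNIV k) < e / 2) at_top"
      using tendstoD[OF G1, of "e/2"] by simp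
    then obtain B1 where B1: "\<And>b. b \<ge> B1 \<Longrightarrow> \<bar>G b - L\<^sub>1 * integral UNIV k\<bar> < e / 2"
      unfolding eventually_at_top_linorder dist_real_def by blast
    have "eventually (\<lambda>a. dist (G a) (L\<^sub>0 * integral UNIV k) < e / 2) at_bot"
      using tendstoD[OF G0, of "e/2"] \<open>e > 0\<close> by simp
    then obtain B0 where B0: "\<And>a. a \<le> B0 \<Longrightarrow> \<bar>G a - L\<^sub>0 * integral UNIV k\<bar> < e / 2"
      unfolding eventually_at_bot_linorder dist_real_def by blast
    show "\<exists>B>0. \<forall>a b. a \<le> - B \<longrightarrow> B \<le> b \<longrightarrow>
        \<bar>integral {a..b} conv - integral UNIV h * integral UNIV k\<bar> < e"
    proof (intro exI[of _ "\<bar>B0\<bar> + \<bar>B1\<bar> + 1"] conjI allI impI)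
      fix a b assume "a \<le> - (\<bar>B0\<bar> + \<bar>B1\<bar> + 1)" "\<bar>B0\<bar> + \<bar>B1\<bar> + 1 \<le> b"
      hence "a \<le> b" "a \<le> B0" "B1 \<le> b" by linarith+
      thus "\<bar>integral {a..b} conv - integral UNIV h * integral UNIV k\<bar> < e"
        using integral_unique[OF FTC[of a b]] B0[of a] B1[of b]
        unfolding Ih left_diff_distrib by linarith
    qed simp
  qed
  thus ?thesis by (simp add: conv_def[abs_def])
qed

section \<open>Multiplication by characters\<close>

text \<open>
  The increment of \<open>c g\<close> is \<open>c y (g y - g x) + (c y - c x) g x\<close>. The first part is
  bounded by the variation of \<open>g\<close>. In the second, \<open>\<bar>c y - c x\<bar>\<close> is at most a multiple of
  \<open>\<delta> = min 1 (y - x)\<close>, and \<open>\<delta> \<bar>g x\<bar>\<close> exceeds the integral of \<open>\<bar>g\<bar>\<close> over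
  \<open>{x..x + \<delta>}\<close> by at most \<open>\<delta>\<close> times the variation of \<open>g\<close> there. Cutting \<open>y - x\<close>
  off at 1 keeps this error below the variation of \<open>g\<close> on \<open>{x..y}\<close>.
\<close>

lemma integrable_variation_imp_modulated_majorant:
  fixes g c :: "real \<Rightarrow> real"
  assumes g: "g absolutely_integrable_on UNIV" and V: "variation_majorant V g"
    and c1: "\<And>x. \<bar>c x\<bar> \<le> 1" and cL: "\<And>x y. \<bar>c x - c y\<bar> \<le> L * \<bar>x - y\<bar>"
  obtains W where "variation_majorant W (\<lambda>x. c x * g x)"
proof -
  have absg: "(\<lambda>x. \<bar>g x\<bar>) integrable_on UNIV"
    using g by (simp add: absolutely_integrable_on_def)
  obtain A L\<^sub>0 L\<^sub>1 where A: "\<And>a b. a \<le> b \<Longrightarrow> ((\<lambda>x. \<bar>g x\<bar>) has_integral (A b - A a)) {a..b}"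
    and bA: "bounded (range A)"
    using primitive_of_integrable[OF absg] by metis
  have Amono: "A x \<le> A y" if "x \<le> y" for x y
    using has_integral_nonneg[OF A[OF that]] by simp
  have Vg: "\<bar>g y - g x\<bar> \<le> V y - V x" if "x \<le> y" for x y
    using V that unfolding variation_majorant_def by blast
  have "0 \<le> L" using cL[of 1 0] by simp
  define K where "K = L + 2"
  define W where "W x = (1 + K) * V x + K * A x" for x
  have "\<bar>c y * g y - c x * g x\<bar> \<le> W y - W x" if xy: "x \<le> y" for x y
  proof -
    define \<delta> where "\<delta> = min 1 (y - x)"
    have \<delta>: "0 \<le> \<delta>" "\<delta> \<le> 1" "x + \<delta> \<le> y" using xy by (auto simp: \<delta>_def)
    have "\<delta> * \<bar>g x\<bar> \<le> (A (x + \<delta>) - A x) + \<delta> * (V y - V x)"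
    proof (rule has_integral_le)
      show "((\<lambda>_. \<bar>g x\<bar>) has_integral (\<delta> * \<bar>g x\<bar>)) {x..x+\<delta>}"
        using has_integral_const_real[of "\<bar>g x\<bar>" x "x + \<delta>"] \<delta> by simp
      show "((\<lambda>z. \<bar>g z\<bar> + (V y - V x)) has_integral
          ((A (x + \<delta>) - A x) + \<delta> * (V y - V x))) {x..x+\<delta>}"
        using has_integral_add[OF A[of x "x + \<delta>"] has_integral_const_real[of "V y - V x" x "x + \<delta>"]] \<delta>
        by simp
      fix z assume "z \<in> {x..x+\<delta>}"
      hence "x \<le> z" "z \<le> y" using \<delta> by auto
      thus "\<bar>g x\<bar> \<le> \<bar>g z\<bar> + (V y - V x)"
        using Vg[of x z] variation_majorant_mono[OF V, of z y] by linarith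
    qed
    also have "\<dots> \<le> (A y - A x) + 1 * (V y - V x)"
      using Amono[of "x + \<delta>" y] \<delta> variation_majorant_mono[OF V xy]
      by (intro add_mono mult_right_mono) auto
    finally have loc: "\<delta> * \<bar>g x\<bar> \<le> (A y - A x) + (V y - V x)" by simp
    have "\<bar>c y - c x\<bar> \<le> K * \<delta>"
    proof (cases "y - x \<le> 1")
      case True
      have "\<bar>c y - c x\<bar> \<le> L * (y - x)" using cL[of y x] xy by simp
      also have "\<dots> \<le> K * (y - x)" using xy by (intro mult_right_mono) (auto simp: K_def)
      finally show ?thesis using True by (simp add: \<delta>_def)
    next
      case False
      thus ?thesis using c1[of x] c1[of y] \<open>0 \<le> L\<close> by (simp add: \<delta>_def K_def)
    qed
    hence "\<bar>c y - c x\<bar> * \<bar>g x\<bar> \<le> K * \<delta> * \<bar>g x\<bar>"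
      by (rule mult_right_mono) simp
    also have "\<dots> \<le> K * ((A y - A x) + (V y - V x))"
      using mult_left_mono[OF loc, of K] \<open>0 \<le> L\<close> by (simp add: K_def mult.assoc)
    finally have 1: "\<bar>(c y - c x) * g x\<bar> \<le> K * ((A y - A x) + (V y - V x))"
      by (simp add: abs_mult)
    have 2: "\<bar>c y * (g y - g x)\<bar> \<le> V y - V x"
      using mult_mono[OF c1[of y] Vg[OF xy]] by (simp add: abs_mult)
    have "c y * g y - c x * g x = c y * (g y - g x) + (c y - c x) * g x"
      by (simp add: algebra_simps)
    hence "\<bar>c y * g y - c x * g x\<bar> \<le> (V y - V x) + K * ((A y - A x) + (V y - V x))"
      using 1 2 by linarith
    also have "\<dots> = W y - W x" by (simp add: W_def algebra_simps)
    finally show ?thesis .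
  qed
  moreover have "bounded (range W)"
  proof -
    have "bounded (range V)" using V by (simp add: variation_majorant_def)
    hence "bounded ((\<lambda>v. (1 + K) *\<^sub>R v) ` range V)" by (rule bounded_scaling)
    moreover have "bounded ((\<lambda>v. K *\<^sub>R v) ` range A)" using bA by (rule bounded_scaling)
    ultimately show ?thesis
      using bounded_plus_comp[of "\<lambda>x. (1 + K) * V x" UNIV "\<lambda>x. K * A x"]
      by (simp add: image_image W_def[abs_def])
  qed
  ultimately show thesis
    by (intro that[of W]) (simp add: variation_majorant_def)
qed

lemma cos_lipschitz: "\<bar>cos x - cos y\<bar> \<le> \<bar>x - y\<bar>" for x y :: real
proof -
  have "\<bar>cos x - cos y\<bar> = 2 * (\<bar>sin ((x + y) / 2)\<bar> * \<bar>sin ((y - x) / 2)\<bar>)"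
    by (simp add: cos_diff_cos abs_mult)
  also have "\<dots> \<le> 2 * (1 * \<bar>(y - x) / 2\<bar>)"
    by (intro mult_left_mono mult_mono abs_sin_le_one abs_sin_x_le_abs_x) auto
  finally show ?thesis by simp
qed

lemma sin_lipschitz: "\<bar>sin x - sin y\<bar> \<le> \<bar>x - y\<bar>" for x y :: real
  using cos_lipschitz[of "pi/2 - x" "pi/2 - y"]
  by (simp add: cos_diff)

lemma modulated_absolutely_integrable_majorant:
  fixes g c :: "real \<Rightarrow> real"
  assumes g: "g absolutely_integrable_on UNIV" and "bounded_variation g"
    and c1: "\<And>x. \<bar>c x\<bar> \<le> 1" and cL: "\<And>x y. \<bar>c x - c y\<bar> \<le> \<bar>x - y\<bar>"
  shows "(\<lambda>x. c (s * x) * g x) absolutely_integrable_on UNIV"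
    and "\<exists>W. variation_majorant W (\<lambda>x. c (s * x) * g x)"
proof -
  have L: "\<bar>c (s * x) - c (s * y)\<bar> \<le> \<bar>s\<bar> * \<bar>x - y\<bar>" for x y
    using cL[of "s * x" "s * y"] by (simp add: abs_mult[symmetric] right_diff_distrib)
  obtain V where "variation_majorant V g"
    using assms(2) by (rule bounded_variation_imp_majorant)
  with g show "\<exists>W. variation_majorant W (\<lambda>x. c (s * x) * g x)"
    using integrable_variation_imp_modulated_majorant[of g V "\<lambda>x. c (s * x)" "\<bar>s\<bar>"] c1 L by metis
  have "\<bar>s\<bar>-lipschitz_on UNIV (\<lambda>x. c (s * x))"
    using L by (intro lipschitz_onI) (auto simp: dist_real_def)
  hence "continuous_on UNIV (\<lambda>x. c (s * x))"
    by (rule lipschitz_on_continuous_on)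
  thus "(\<lambda>x. c (s * x) * g x) absolutely_integrable_on UNIV"
    using g c1 by (intro absolutely_integrable_bounded_continuous_product boundedI[of _ 1]) auto
qed

text \<open>
  The sine integral is minus the imaginary part because the kernel is \<open>exp (- i s x)\<close>.
\<close>

lemma fourier_has_integral_iff:
  "((\<lambda>x. exp (- \<i> * of_real s * of_real x) * complex_of_real (f x)) has_integral z) UNIV \<longleftrightarrow>
     ((\<lambda>x. cos (s * x) * f x) has_integral Re z) UNIV \<and>
     ((\<lambda>x. sin (s * x) * f x) has_integral - Im z) UNIV"
proof -
  have e: "exp (- \<i> * of_real s * of_real x) * complex_of_real (f x) =
      Complex (cos (s * x) * f x) (- (sin (s * x) * f x))" for x
  proof -
    have "- \<i> * of_real s * of_real x = \<i> * complex_of_real (- (s * x))" by simp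
    thus ?thesis
      by (simp only: exp_Euler[symmetric] cis_conv_exp[symmetric]) (simp add: complex_eq_iff)
  qed
  have "((\<lambda>x. exp (- \<i> * of_real s * of_real x) * complex_of_real (f x)) has_integral z) UNIV \<longleftrightarrow>
     ((\<lambda>x. cos (s * x) * f x) has_integral Re z) UNIV \<and>
     ((\<lambda>x. - (sin (s * x) * f x)) has_integral Im z) UNIV"
    unfolding e by (subst has_integral_componentwise_iff) (simp add: Basis_complex_def)
  also have "((\<lambda>x. - (sin (s * x) * f x)) has_integral Im z) UNIV \<longleftrightarrow>
      ((\<lambda>x. sin (s * x) * f x) has_integral - Im z) UNIV"
    by (rule has_integral_neg_iff)
  finally show ?thesis .
qed

theorem proposition14:
  fixes f g :: "real \<Rightarrow> real" and s :: real
  assumes "fourier_exists f s"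
    and "g absolutely_integrable_on UNIV"
    and "bounded_variation g"
  shows "(\<forall>x. convolution_exists f g x) \<and>
         fourier_exists (convolution f g) s \<and>
         fourier_exists g s \<and>
         fourier (convolution f g) s = fourier f s * fourier g s"
proof -
  define h1 h2 k1 k2 where "h1 x = cos (s * x) * f x" and "h2 x = sin (s * x) * f x"
    and "k1 x = cos (s * x) * g x" and "k2 x = sin (s * x) * g x" for x
  have "((\<lambda>x. exp (- \<i> * of_real s * of_real x) * complex_of_real (f x)) has_integral fourier f s) UNIV"
    using assms(1) unfolding fourier_exists_def fourier_def by (rule integrable_integral)
  hence h: "(h1 has_integral Re (fourier f s)) UNIV" "(h2 has_integral - Im (fourier f s)) UNIV"
    unfolding fourier_has_integral_iff h1_def h2_def by auto
  have k_abs: "k1 absolutely_integrable_on UNIV" "k2 absolutely_integrable_on UNIV"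
    and "\<exists>W. variation_majorant W k1" "\<exists>W. variation_majorant W k2"
    using modulated_absolutely_integrable_majorant[OF assms(2,3), of cos s]
      modulated_absolutely_integrable_majorant[OF assms(2,3), of sin s]
    by (simp_all add: cos_lipschitz sin_lipschitz k1_def[abs_def] k2_def[abs_def])
  then obtain W1 W2 where W: "variation_majorant W1 k1" "variation_majorant W2 k2" by blast
  have k_int: "k1 integrable_on UNIV" "k2 integrable_on UNIV"
    using k_abs by (simp_all add: absolutely_integrable_on_def)
  have "((\<lambda>x. exp (- \<i> * of_real s * of_real x) * complex_of_real (g x)) has_integral
      Complex (integral UNIV k1) (- integral UNIV k2)) UNIV"
    unfolding fourier_has_integral_iff
    using k_int[THEN integrable_integral] by (simp add: k1_def[abs_def] k2_def[abs_def])
  hence g_ex: "fourier_exists g s"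
    and g_val: "fourier g s = Complex (integral UNIV k1) (- integral UNIV k2)"
    unfolding fourier_exists_def fourier_def by (auto intro: integral_unique)

  define I where "I h k x = integral UNIV (\<lambda>t. h (x - t) * k t)" for h k :: "real \<Rightarrow> real" and x
  have h_int: "h1 integrable_on UNIV" "h2 integrable_on UNIV"
    using h by blast+
  have I: "((\<lambda>t. h (x - t) * k t) has_integral I h k x) UNIV"
    if "h integrable_on UNIV" "variation_majorant W k" for h k W x
    unfolding I_def
    using integrable_bounded_variation_product[OF that(2) integrable_reflect_shift[OF that(1)]]
    by (rule integrable_integral)
  have C: "((\<lambda>t. cos (s * x) * (f (x - t) * g t)) has_integral (I h1 k1 x - I h2 k2 x)) UNIV" for x
  proof -
    have "h1 (x - t) * k1 t - h2 (x - t) * k2 t = cos (s * x) * (f (x - t) * g t)" for t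
    proof -
      have e: "cos (s * x) = cos (s * (x - t)) * cos (s * t) - sin (s * (x - t)) * sin (s * t)"
        using cos_add[of "s * (x - t)" "s * t"] by (simp add: right_diff_distrib)
      show ?thesis
        unfolding h1_def h2_def k1_def k2_def e by (simp add: algebra_simps)
    qed
    thus ?thesis
      using has_integral_diff[OF I[OF h_int(1) W(1), of x] I[OF h_int(2) W(2), of x]] by simp
  qed
  have S: "((\<lambda>t. sin (s * x) * (f (x - t) * g t)) has_integral (I h2 k1 x + I h1 k2 x)) UNIV" for x
  proof -
    have "h2 (x - t) * k1 t + h1 (x - t) * k2 t = sin (s * x) * (f (x - t) * g t)" for t
    proof -
      have e: "sin (s * x) = sin (s * (x - t)) * cos (s * t) + cos (s * (x - t)) * sin (s * t)"
        using sin_add[of "s * (x - t)" "s * t"] by (simp add: right_diff_distrib)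
      show ?thesis
        unfolding h1_def h2_def k1_def k2_def e by (simp add: algebra_simps)
    qed
    thus ?thesis
      using has_integral_add[OF I[OF h_int(2) W(1), of x] I[OF h_int(1) W(2), of x]] by simp
  qed
  (* Neither cos (s * x) nor sin (s * x) can be divided out, as it may vanish; instead the two
     integrals are recombined using that the squares add up to 1. *)
  have conv_ex: "convolution_exists f g x" for x
  proof -
    have "((\<lambda>t. cos (s * x) * (cos (s * x) * (f (x - t) * g t)) +
        sin (s * x) * (sin (s * x) * (f (x - t) * g t))) has_integral
        (cos (s * x) * (I h1 k1 x - I h2 k2 x) + sin (s * x) * (I h2 k1 x + I h1 k2 x))) UNIV"
      by (intro has_integral_add has_integral_mult_right C S)
    moreover have "cos (s * x) * (cos (s * x) * r) + sin (s * x) * (sin (s * x) * r) = r" for r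
      using sin_cos_squared_add2[of "s * x"]
      by (metis distrib_right mult.assoc mult_1 power2_eq_square)
    ultimately show ?thesis
      unfolding convolution_exists_def by auto
  qed
  have Cx: "cos (s * x) * convolution f g x = I h1 k1 x - I h2 k2 x" for x
    using integral_unique[OF C[of x]] by (simp add: convolution_def)
  have Sx: "sin (s * x) * convolution f g x = I h2 k1 x + I h1 k2 x" for x
    using integral_unique[OF S[of x]] by (simp add: convolution_def)
  have II: "(I h k has_integral (integral UNIV h * integral UNIV k)) UNIV"
    if "h integrable_on UNIV" "k absolutely_integrable_on UNIV" "variation_majorant W k" for h k W
    using convolution_has_integral[OF that] by (simp add: I_def[abs_def])
  have "((\<lambda>x. cos (s * x) * convolution f g x) has_integral
      (integral UNIV h1 * integral UNIV k1 - integral UNIV h2 * integral UNIV k2)) UNIV"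
    unfolding Cx by (intro has_integral_diff II[OF h_int(1) k_abs(1) W(1)] II[OF h_int(2) k_abs(2) W(2)])
  moreover have "((\<lambda>x. sin (s * x) * convolution f g x) has_integral
      (integral UNIV h2 * integral UNIV k1 + integral UNIV h1 * integral UNIV k2)) UNIV"
    unfolding Sx by (intro has_integral_add II[OF h_int(2) k_abs(1) W(1)] II[OF h_int(1) k_abs(2) W(2)])
  ultimately have "((\<lambda>x. exp (- \<i> * of_real s * of_real x) * complex_of_real (convolution f g x))
      has_integral (fourier f s * fourier g s)) UNIV"
    unfolding fourier_has_integral_iff
    using integral_unique[OF h(1)] integral_unique[OF h(2)] by (simp add: g_val algebra_simps)
  hence "fourier_exists (convolution f g) s"
    "fourier (convolution f g) s = fourier f s * fourier g s"
    unfolding fourier_exists_def by (auto simp: fourier_def intro: integral_unique)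
  with conv_ex g_ex show ?thesis by blast
qed

end
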